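(* Let $(G,C)$ be an edge-colored graph on $n$ vertices. Suppose that $\delta^c(G)\geq \frac{n+1}{2}$ and, subject to this, $e(G)$ is minimal. Then $$rt(G)\geq\frac{e(G)\,(\overline{\sigma}^c_2(G)-n)}{3}+\frac{1}{6}\sum_{v\in V(G)}(n-d(v)-1)(d(v)-d^c(v)).$$
   Context: All graphs are finite, undirected and simple. An edge-colored graph $(G,C)$ is a graph $G$ with an arbitrary function $C:E(G)\to\mathbb{N}$ (not necessarily a proper coloring). $d(v)$ is the usual degree of $v$; $e(G)$ is the number of edges. The color degree $d^c(v)$ is the number of distinct colors appearing on edges incident with $v$; $\delta^c(G)=\min_{v\in V(G)} d^c(v)$. $\overline{\sigma}^c_2(G)=\min\{d^c(x)+d^c(y):xy\in E(G)\}$. A triangle is rainbow if its three edges have pairwise distinct colors; $rt(G)$ is the number of rainbow triangles in $G$. "$e(G)$ is minimal" means: deleting any single edge of $G$ decreases the color degree of some vertex of $G$. *)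

theory Defs
  imports Complex_Main
begin

definition simple_graph :: "'a set \<Rightarrow> 'a set set \<Rightarrow> bool" where
  "simple_graph V E \<longleftrightarrow> finite V \<and> (\<forall>e\<in>E. e \<subseteq> V \<and> card e = 2)"

definition degree :: "'a set set \<Rightarrow> 'a \<Rightarrow> nat" where
  "degree E v = card {e \<in> E. v \<in> e}"

text \<open>An edge coloring is a total function on sets of vertices; only its values on the edge set
  are ever used. It need not be proper.\<close>

definition color_degree :: "'a set set \<Rightarrow> ('a set \<Rightarrow> nat) \<Rightarrow> 'a \<Rightarrow> nat" where
  "color_degree E C v = card (C ` {e \<in> E. v \<in> e})"

definition min_color_degree :: "'a set \<Rightarrow> 'a set set \<Rightarrow> ('a set \<Rightarrow> nat) \<Rightarrow> nat" where
  "min_color_degree V E C = Min (color_degree E C ` V)"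

definition min_edge_color_degree_sum :: "'a set set \<Rightarrow> ('a set \<Rightarrow> nat) \<Rightarrow> nat" where
  "min_edge_color_degree_sum E C =
     Min {color_degree E C x + color_degree E C y | x y. {x, y} \<in> E}"

text \<open>A triangle is identified with its set of three vertices, so each one is counted once. In a
  simple graph the three edge conditions force \<open>x\<close>, \<open>y\<close>, \<open>z\<close> to be distinct.\<close>

definition rainbow_triangles :: "'a set set \<Rightarrow> ('a set \<Rightarrow> nat) \<Rightarrow> 'a set set" where
  "rainbow_triangles E C =
     {{x, y, z} | x y z. {x, y} \<in> E \<and> {y, z} \<in> E \<and> {x, z} \<in> E \<and>
        C {x, y} \<noteq> C {y, z} \<and> C {y, z} \<noteq> C {x, z} \<and> C {x, y} \<noteq> C {x, z}}"

definition rt :: "'a set set \<Rightarrow> ('a set \<Rightarrow> nat) \<Rightarrow> nat" where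
  "rt E C = card (rainbow_triangles E C)"

definition edge_minimal :: "'a set \<Rightarrow> 'a set set \<Rightarrow> ('a set \<Rightarrow> nat) \<Rightarrow> bool" where
  "edge_minimal V E C \<longleftrightarrow>
     (\<forall>e\<in>E. \<exists>v\<in>V. color_degree (E - {e}) C v < color_degree E C v)"

end

theory Submission
  imports Defs
begin

text \<open>
  Write \<open>d\<close> and \<open>c\<close> for degree and color degree. The proof counts ordered triangles. Adjacent
  vertices \<open>x\<close>, \<open>y\<close> have at least \<open>d(x) + d(y) - n\<close> common neighbours, so summing over ordered
  adjacent pairs gives at least \<open>\<Sum>v. 2 d(v)\<^sup>2 - n d(v)\<close> ordered triangles
  (\<open>ordered_triangles_lower_bound\<close>).

  A triangle that is not rainbow has two equally colored edges meeting in some vertex \<open>v\<close>. If the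
  color classes at \<open>v\<close> have sizes \<open>s\<^sub>1, \<dots>, s\<^sub>k\<close> with \<open>k = c(v)\<close>, then \<open>v\<close> is the apex of at most
  \<open>\<Sum>i. s\<^sub>i (s\<^sub>i - 1)\<close> such ordered pairs of edges. The numbers \<open>s\<^sub>i - 1\<close> are nonnegative and sum to
  \<open>d(v) - c(v)\<close>, so each is at most \<open>d(v) - c(v)\<close>, and the count is at most
  \<open>(d(v) - c(v) + 1) (d(v) - c(v))\<close> (\<open>monochromatic_pairs_upper_bound\<close>). The apex can stand in any
  of three positions of an ordered triangle, and every rainbow triangle has six orderings, so
  \<open>6 rt \<ge> \<Sum>v. 2 d(v)\<^sup>2 - n d(v) - 3 (d(v) - c(v) + 1) (d(v) - c(v))\<close>.

  On the other side, double counting incidences gives \<open>2 e = \<Sum>v. d(v)\<close> and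
  \<open>e \<sigma> \<le> \<Sum>v. d(v) c(v)\<close>, where \<open>\<sigma>\<close> is the minimum of \<open>c(x) + c(y)\<close> over edges \<open>xy\<close>. After these
  substitutions the claim holds vertex by vertex: the difference of the two summands at \<open>v\<close> is
  \<open>(d(v) - c(v)) (3 c(v) - n - 2)\<close>, and \<open>c(v) \<ge> (n + 1) / 2\<close> makes the second factor
  nonnegative once \<open>n \<ge> 1\<close>.
\<close>

definition neighbors :: "'a set set \<Rightarrow> 'a \<Rightarrow> 'a set" where
  "neighbors E v = {w. {v, w} \<in> E}"

definition ordered_triangles :: "'a set set \<Rightarrow> ('a \<times> 'a \<times> 'a) set" where
  "ordered_triangles E = {(x, y, z). {x, y} \<in> E \<and> {y, z} \<in> E \<and> {x, z} \<in> E}"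

definition ordered_rainbow_triangles ::
    "'a set set \<Rightarrow> ('a set \<Rightarrow> nat) \<Rightarrow> ('a \<times> 'a \<times> 'a) set" where
  "ordered_rainbow_triangles E C = {(x, y, z). {x, y} \<in> E \<and> {y, z} \<in> E \<and> {x, z} \<in> E \<and>
     C {x, y} \<noteq> C {y, z} \<and> C {y, z} \<noteq> C {x, z} \<and> C {x, y} \<noteq> C {x, z}}"

text \<open>The first component of a triple is the apex, the common end of the two equally colored edges.
  The other two components need not be adjacent.\<close>

definition monochromatic_pairs ::
    "'a set set \<Rightarrow> ('a set \<Rightarrow> nat) \<Rightarrow> ('a \<times> 'a \<times> 'a) set" where
  "monochromatic_pairs E C =
     {(v, x, y). {v, x} \<in> E \<and> {v, y} \<in> E \<and> x \<noteq> y \<and> C {v, x} = C {v, y}}"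


section \<open>Degrees and double counting\<close>

lemma simple_graph_edgeD:
  assumes "simple_graph V E" "{x, y} \<in> E"
  shows "x \<in> V" "y \<in> V" "x \<noteq> y"
  using assms by (auto simp: simple_graph_def)

lemma finite_edges: "simple_graph V E \<Longrightarrow> finite E"
  unfolding simple_graph_def by (meson Pow_iff finite_Pow_iff finite_subset subsetI)

lemma neighbors_subset: "simple_graph V E \<Longrightarrow> neighbors E v \<subseteq> V"
  by (auto simp: neighbors_def dest: simple_graph_edgeD)

lemma finite_neighbors: "simple_graph V E \<Longrightarrow> finite (neighbors E v)"
  using neighbors_subset finite_subset by (metis simple_graph_def)

lemma incident_edges_eq:
  assumes "simple_graph V E"
  shows "{e \<in> E. v \<in> e} = (\<lambda>w. {v, w}) ` neighbors E v"
proof -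
  have "\<exists>w. e = {v, w}" if "e \<in> E" "v \<in> e" for e
  proof -
    have "card e = 2" using assms that by (auto simp: simple_graph_def)
    then show ?thesis using that(2) by (auto simp: card_2_iff)
  qed
  then show ?thesis by (force simp: neighbors_def)
qed

lemma degree_eq_card_neighbors:
  assumes "simple_graph V E"
  shows "degree E v = card (neighbors E v)"
  unfolding degree_def incident_edges_eq[OF assms]
  by (rule card_image) (auto simp: inj_on_def doubleton_eq_iff)

lemma color_degree_eq_card_image:
  assumes "simple_graph V E"
  shows "color_degree E C v = card ((\<lambda>w. C {v, w}) ` neighbors E v)"
  unfolding color_degree_def incident_edges_eq[OF assms] image_image ..

lemma color_degree_le_degree:
  assumes "simple_graph V E"
  shows "color_degree E C v \<le> degree E v"
  unfolding color_degree_def degree_def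
  using finite_edges[OF assms] by (intro card_image_le) auto

text \<open>Double counting of incidences; the weight \<open>1\<close> gives the handshake identity.\<close>

lemma sum_degree_weighted:
  fixes f :: "'a \<Rightarrow> real"
  assumes "simple_graph V E"
  shows "(\<Sum>v\<in>V. real (degree E v) * f v) = (\<Sum>e\<in>E. \<Sum>v\<in>e. f v)"
proof -
  have "(\<Sum>v\<in>V. real (degree E v) * f v) = (\<Sum>v\<in>V. \<Sum>e | e \<in> E \<and> v \<in> e. f v)"
    by (simp add: degree_def)
  also have "\<dots> = (\<Sum>e\<in>E. \<Sum>v | v \<in> V \<and> v \<in> e. f v)"
    using assms finite_edges[OF assms]
    by (intro sum.swap_restrict) (auto simp: simple_graph_def)
  also have "\<dots> = (\<Sum>e\<in>E. \<Sum>v\<in>e. f v)"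
    using assms by (intro sum.cong) (auto simp: simple_graph_def)
  finally show ?thesis .
qed

lemma handshake:
  assumes "simple_graph V E"
  shows "(\<Sum>v\<in>V. real (degree E v)) = 2 * real (card E)"
proof -
  have "(\<Sum>e\<in>E. \<Sum>v\<in>e. 1::real) = (\<Sum>e\<in>E. 2)"
    using assms by (intro sum.cong) (auto simp: simple_graph_def)
  then show ?thesis using sum_degree_weighted[OF assms, of "\<lambda>_. 1"] by simp
qed

lemma edges_times_min_edge_color_degree_sum_le:
  assumes "simple_graph V E"
  shows "real (card E) * real (min_edge_color_degree_sum E C)
           \<le> (\<Sum>v\<in>V. real (degree E v) * real (color_degree E C v))"
proof -
  let ?S = "{color_degree E C x + color_degree E C y | x y. {x, y} \<in> E}"
  have "?S \<subseteq> (\<lambda>(x, y). color_degree E C x + color_degree E C y) ` (V \<times> V)"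
    using simple_graph_edgeD[OF assms] by fast
  then have fin: "finite ?S"
    by (rule finite_subset) (use assms in \<open>auto simp: simple_graph_def\<close>)
  have "real (min_edge_color_degree_sum E C) \<le> (\<Sum>v\<in>e. real (color_degree E C v))"
    if "e \<in> E" for e
  proof -
    have "card e = 2" using assms that by (auto simp: simple_graph_def)
    then obtain x y where e: "e = {x, y}" "x \<noteq> y" by (auto simp: card_2_iff)
    have "min_edge_color_degree_sum E C \<le> color_degree E C x + color_degree E C y"
      unfolding min_edge_color_degree_sum_def using fin that e by (intro Min_le) auto
    then show ?thesis using e by simp
  qed
  then have "(\<Sum>e\<in>E. real (min_edge_color_degree_sum E C))
               \<le> (\<Sum>e\<in>E. \<Sum>v\<in>e. real (color_degree E C v))"
    by (rule sum_mono)
  then show ?thesis by (simp add: sum_degree_weighted[OF assms])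
qed


section \<open>Ordered triangles from codegrees\<close>

lemma ordered_triangles_lower_bound:
  assumes "simple_graph V E"
  shows "(\<Sum>v\<in>V. 2 * real (degree E v) ^ 2 - real (card V) * real (degree E v))
           \<le> real (card (ordered_triangles E))"
proof -
  let ?N = "neighbors E" and ?d = "\<lambda>v. real (degree E v)"
  have finV: "finite V" using assms by (simp add: simple_graph_def)
  have finN: "finite (?N v)" for v by (rule finite_neighbors[OF assms])
  have deg: "degree E v = card (?N v)" for v by (rule degree_eq_card_neighbors[OF assms])
  have codegree: "?d x + ?d y - real (card V) \<le> real (card (?N x \<inter> ?N y))" for x y
  proof -
    have "card (?N x \<union> ?N y) \<le> card V"
      using neighbors_subset[OF assms] finV by (intro card_mono) auto
    then show ?thesis
      using card_Un_Int[OF finN finN, of x y] unfolding deg by linarith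
  qed
  have "ordered_triangles E = (SIGMA x:V. SIGMA y:?N x. ?N x \<inter> ?N y)"
    by (auto simp: ordered_triangles_def neighbors_def dest: simple_graph_edgeD[OF assms])
  then have card_T: "real (card (ordered_triangles E))
      = (\<Sum>x\<in>V. \<Sum>y\<in>?N x. real (card (?N x \<inter> ?N y)))"
    using finV finN by (simp add: card_SigmaI)
  have swap: "(\<Sum>x\<in>V. \<Sum>y\<in>?N x. ?d y) = (\<Sum>y\<in>V. ?d y ^ 2)"
  proof -
    have "(\<Sum>x\<in>V. \<Sum>y\<in>?N x. ?d y) = (\<Sum>x\<in>V. \<Sum>y | y \<in> V \<and> y \<in> ?N x. ?d y)"
      using neighbors_subset[OF assms] by (intro sum.cong) auto
    also have "\<dots> = (\<Sum>y\<in>V. \<Sum>x | x \<in> V \<and> y \<in> ?N x. ?d y)"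
      by (rule sum.swap_restrict[OF finV finV])
    also have "\<dots> = (\<Sum>y\<in>V. ?d y ^ 2)"
    proof (rule sum.cong[OF refl])
      fix y
      have "{x. x \<in> V \<and> y \<in> ?N x} = ?N y"
        by (auto simp: neighbors_def insert_commute dest: simple_graph_edgeD[OF assms])
      then show "(\<Sum>x | x \<in> V \<and> y \<in> ?N x. ?d y) = ?d y ^ 2"
        by (simp add: deg power2_eq_square)
    qed
    finally show ?thesis .
  qed
  have "(\<Sum>v\<in>V. 2 * ?d v ^ 2 - real (card V) * ?d v)
      = (\<Sum>x\<in>V. ?d x ^ 2 - real (card V) * ?d x) + (\<Sum>x\<in>V. ?d x ^ 2)"
    by (simp add: sum.distrib[symmetric] algebra_simps)
  also have "\<dots> = (\<Sum>x\<in>V. \<Sum>y\<in>?N x. ?d x + ?d y - real (card V))"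
    unfolding swap[symmetric] sum.distrib[symmetric]
    by (intro sum.cong refl)
       (simp add: sum.distrib sum_subtractf deg power2_eq_square algebra_simps)
  also have "\<dots> \<le> real (card (ordered_triangles E))"
    unfolding card_T by (intro sum_mono codegree)
  finally show ?thesis .
qed


section \<open>Triangles that are not rainbow\<close>

text \<open>Since \<open>f\<close> takes \<open>card (f ` A)\<close> values, the fibre sizes minus one sum to
  \<open>card A - card (f ` A)\<close>. This quantity also bounds each of them, so a sum of terms
  \<open>s (s - 1)\<close> is controlled by the sum of the terms \<open>s - 1\<close>.\<close>

lemma same_fibre_pairs_le:
  fixes f :: "'a \<Rightarrow> 'b"
  assumes A: "finite A"
  shows "real (card {(x, y). x \<in> A \<and> y \<in> A \<and> x \<noteq> y \<and> f x = f y})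
           \<le> (real (card A) - real (card (f ` A)) + 1) * (real (card A) - real (card (f ` A)))"
proof -
  define F where "F i = {x \<in> A. f x = i}" for i
  define s where "s i = real (card (F i))" for i
  let ?I = "f ` A"
  have finF: "finite (F i)" for i using A by (simp add: F_def)
  have s_pos: "1 \<le> s i" if "i \<in> ?I" for i
  proof -
    have "F i \<noteq> {}" using that by (auto simp: F_def)
    then show ?thesis using finF[of i] by (simp add: s_def Suc_leI card_gt_0_iff)
  qed
  have "card A = (\<Sum>i\<in>?I. card (F i))"
    unfolding F_def using sum.image_gen[OF A, of "\<lambda>_. 1::nat" f] by simp
  then have excess: "(\<Sum>i\<in>?I. s i - 1) = real (card A) - real (card ?I)"
    by (simp add: s_def sum_subtractf)
  have s_le: "s i \<le> real (card A) - real (card ?I) + 1" if "i \<in> ?I" for i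
  proof -
    have "s i - 1 \<le> (\<Sum>i\<in>?I. s i - 1)"
      using A that s_pos by (intro member_le_sum) auto
    then show ?thesis using excess by simp
  qed
  have "{(x, y). x \<in> A \<and> y \<in> A \<and> x \<noteq> y \<and> f x = f y}
      = (\<Union>i\<in>?I. SIGMA x:F i. F i - {x})"
    by (auto simp: F_def)
  also have "card \<dots> \<le> (\<Sum>i\<in>?I. card (SIGMA x:F i. F i - {x}))"
    using A by (intro card_UN_le) auto
  also have "real \<dots> = (\<Sum>i\<in>?I. s i * (s i - 1))"
  proof -
    have "real (card (SIGMA x:F i. F i - {x})) = s i * (s i - 1)" if "i \<in> ?I" for i
    proof -
      have "card (SIGMA x:F i. F i - {x}) = (\<Sum>x\<in>F i. card (F i) - 1)"
        using finF by (simp add: card_SigmaI)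
      then show ?thesis using s_pos[OF that] by (simp add: s_def of_nat_diff)
    qed
    then show ?thesis by simp
  qed
  also have "\<dots> \<le> (\<Sum>i\<in>?I. (real (card A) - real (card ?I) + 1) * (s i - 1))"
    using s_le s_pos by (intro sum_mono mult_right_mono) auto
  also have "\<dots> = (real (card A) - real (card ?I) + 1) * (real (card A) - real (card ?I))"
    unfolding sum_distrib_left[symmetric] excess ..
  finally show ?thesis by simp
qed

lemma monochromatic_pairs_eq_Sigma:
  assumes "simple_graph V E"
  shows "monochromatic_pairs E C = (SIGMA v:V. {(x, y). x \<in> neighbors E v \<and>
           y \<in> neighbors E v \<and> x \<noteq> y \<and> C {v, x} = C {v, y}})"
  by (auto simp: monochromatic_pairs_def neighbors_def dest: simple_graph_edgeD[OF assms])

lemma finite_same_color_neighbors: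
  assumes "simple_graph V E"
  shows "finite {(x, y). x \<in> neighbors E v \<and> y \<in> neighbors E v \<and> x \<noteq> y \<and> C {v, x} = C {v, y}}"
  by (rule finite_subset[of _ "neighbors E v \<times> neighbors E v"])
     (use finite_neighbors[OF assms] in auto)

lemma finite_monochromatic_pairs:
  assumes "simple_graph V E"
  shows "finite (monochromatic_pairs E C)"
  unfolding monochromatic_pairs_eq_Sigma[OF assms]
  using assms finite_same_color_neighbors[OF assms]
  by (intro finite_SigmaI) (auto simp: simple_graph_def)

lemma monochromatic_pairs_upper_bound:
  assumes "simple_graph V E"
  shows "real (card (monochromatic_pairs E C))
           \<le> (\<Sum>v\<in>V. (real (degree E v) - real (color_degree E C v) + 1)
                      * (real (degree E v) - real (color_degree E C v)))"
proof -
  have "real (card (monochromatic_pairs E C)) = (\<Sum>v\<in>V. real (card {(x, y). x \<in> neighbors E v \<and>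
           y \<in> neighbors E v \<and> x \<noteq> y \<and> C {v, x} = C {v, y}}))"
    unfolding monochromatic_pairs_eq_Sigma[OF assms]
    using assms finite_same_color_neighbors[OF assms]
    by (subst card_SigmaI) (auto simp: simple_graph_def)
  also have "\<dots> \<le> (\<Sum>v\<in>V. (real (degree E v) - real (color_degree E C v) + 1)
                      * (real (degree E v) - real (color_degree E C v)))"
    unfolding degree_eq_card_neighbors[OF assms] color_degree_eq_card_image[OF assms]
    by (intro sum_mono same_fibre_pairs_le finite_neighbors[OF assms])
  finally show ?thesis .
qed

text \<open>A triangle that is not rainbow is a monochromatic pair after its apex is moved to the front;
  the three positions it can have in the ordering account for the factor \<open>3\<close>.\<close>

lemma ordered_triangles_le_rainbow_plus_monochromatic:
  assumes "simple_graph V E"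
  shows "card (ordered_triangles E)
           \<le> card (ordered_rainbow_triangles E C) + 3 * card (monochromatic_pairs E C)"
proof -
  let ?M = "monochromatic_pairs E C" and ?R = "ordered_rainbow_triangles E C"
  define A where "A = (\<lambda>(v, x, y). (x, v, y)) ` ?M"
  define B where "B = (\<lambda>(v, x, y). (x, y, v)) ` ?M"
  have finM: "finite ?M" by (rule finite_monochromatic_pairs[OF assms])
  have "?R \<subseteq> V \<times> V \<times> V"
    by (auto simp: ordered_rainbow_triangles_def dest: simple_graph_edgeD[OF assms])
  then have finR: "finite ?R"
    by (rule finite_subset) (use assms in \<open>auto simp: simple_graph_def\<close>)
  have "ordered_triangles E \<subseteq> ?R \<union> (?M \<union> (A \<union> B))"
  proof
    fix t assume t: "t \<in> ordered_triangles E"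
    obtain x y z where txyz: "t = (x, y, z)" by (cases t) auto
    have edges: "{x, y} \<in> E" "{y, z} \<in> E" "{x, z} \<in> E" "{y, x} \<in> E" "{z, y} \<in> E" "{z, x} \<in> E"
      using t by (auto simp: txyz ordered_triangles_def insert_commute)
    note distinct = edges(1,2,3)[THEN simple_graph_edgeD(3)[OF assms]]
    consider "t \<in> ?R" | "C {x, y} = C {x, z}" | "C {y, x} = C {y, z}" | "C {z, x} = C {z, y}"
      using edges by (simp add: txyz ordered_rainbow_triangles_def insert_commute) metis
    then show "t \<in> ?R \<union> (?M \<union> (A \<union> B))"
    proof cases
      case 2
      then have "(x, y, z) \<in> ?M" using edges distinct by (simp add: monochromatic_pairs_def)
      then show ?thesis by (simp add: txyz)
    next
      case 3
      then have "(y, x, z) \<in> ?M" using edges distinct by (simp add: monochromatic_pairs_def)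
      then show ?thesis by (force simp: txyz A_def)
    next
      case 4
      then have "(z, x, y) \<in> ?M" using edges distinct by (simp add: monochromatic_pairs_def)
      then show ?thesis by (force simp: txyz B_def)
    qed simp
  qed
  then have "card (ordered_triangles E) \<le> card (?R \<union> (?M \<union> (A \<union> B)))"
    using finM finR by (intro card_mono) (auto simp: A_def B_def)
  also have "\<dots> \<le> card ?R + (card ?M + (card A + card B))"
    by (meson add_left_mono card_Un_le order_trans)
  also have "\<dots> \<le> card ?R + 3 * card ?M"
    using card_image_le[OF finM, of "\<lambda>(v, x, y). (x, v, y)"]
      card_image_le[OF finM, of "\<lambda>(v, x, y). (x, y, v)"] by (simp add: A_def B_def)
  finally show ?thesis .
qed


section \<open>Counting rainbow triangles\<close>

lemma card_orderings_le_6: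
  assumes "card t = 3"
  shows "finite {(x, y, z). {x, y, z} = t}" "card {(x, y, z). {x, y, z} = t} \<le> 6"
proof -
  obtain a b c where t: "t = {a, b, c}" "a \<noteq> b" "a \<noteq> c" "b \<noteq> c"
    using assms by (auto simp: card_3_iff)
  define P where "P = {(a, b, c), (a, c, b), (b, a, c), (b, c, a), (c, a, b), (c, b, a)}"
  have sub: "{(x, y, z). {x, y, z} = t} \<subseteq> P"
  proof
    fix p assume "p \<in> {(x, y, z). {x, y, z} = t}"
    then obtain x y z where p: "p = (x, y, z)" and xyz: "{x, y, z} = t" by auto
    then have "x \<in> t" "y \<in> t" "z \<in> t" "a \<in> {x, y, z}" "b \<in> {x, y, z}" "c \<in> {x, y, z}"
      using t by auto
    then show "p \<in> P" using t by (auto simp: P_def p)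
  qed
  have "finite P" by (simp add: P_def)
  then show "finite {(x, y, z). {x, y, z} = t}" by (rule finite_subset[OF sub])
  have "card P = 6" using t by (simp add: P_def)
  then show "card {(x, y, z). {x, y, z} = t} \<le> 6" using card_mono[OF \<open>finite P\<close> sub] by simp
qed

lemma ordered_rainbow_triangles_le:
  assumes "simple_graph V E"
  shows "card (ordered_rainbow_triangles E C) \<le> 6 * rt E C"
proof -
  let ?T = "rainbow_triangles E C" and ?O = "\<lambda>t. {(x, y, z). {x, y, z} = t}"
  have card3: "card t = 3" if "t \<in> ?T" for t
    using that simple_graph_edgeD(3)[OF assms] by (fastforce simp: rainbow_triangles_def)
  have "?T \<subseteq> Pow V"
    using simple_graph_edgeD[OF assms] by (fastforce simp: rainbow_triangles_def)
  then have finT: "finite ?T"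
    by (rule finite_subset) (use assms in \<open>auto simp: simple_graph_def\<close>)
  have "ordered_rainbow_triangles E C \<subseteq> (\<Union>t\<in>?T. ?O t)"
    by (auto simp: ordered_rainbow_triangles_def rainbow_triangles_def)
  then have "card (ordered_rainbow_triangles E C) \<le> card (\<Union>t\<in>?T. ?O t)"
    using finT card_orderings_le_6(1)[OF card3] by (intro card_mono finite_UN_I) auto
  also have "\<dots> \<le> (\<Sum>t\<in>?T. card (?O t))" by (rule card_UN_le[OF finT])
  also have "\<dots> \<le> (\<Sum>t\<in>?T. 6)" by (intro sum_mono card_orderings_le_6(2) card3)
  finally show ?thesis by (simp add: rt_def)
qed


theorem theorem3:
  fixes V :: "'a set" and E :: "'a set set" and C :: "'a set \<Rightarrow> nat" and n :: nat
  assumes "simple_graph V E"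
    and "card V = n"
    and "real (min_color_degree V E C) \<ge> (real n + 1) / 2"
    and "edge_minimal V E C"
  shows "real (rt E C) \<ge>
           real (card E) * (real (min_edge_color_degree_sum E C) - real n) / 3
           + 1 / 6 * (\<Sum>v\<in>V. (real n - real (degree E v) - 1)
                              * (real (degree E v) - real (color_degree E C v)))"
proof -
  define d c where "d v = real (degree E v)" and "c v = real (color_degree E C v)" for v
  define \<sigma> where "\<sigma> = real (min_edge_color_degree_sum E C)"
  have finV: "finite V" using assms(1) by (simp add: simple_graph_def)
  have rainbow: "(\<Sum>v\<in>V. 2 * d v ^ 2 - real n * d v) - 3 * (\<Sum>v\<in>V. (d v - c v + 1) * (d v - c v))
      \<le> 6 * real (rt E C)"
    using ordered_triangles_lower_bound[OF assms(1)]
      monochromatic_pairs_upper_bound[OF assms(1), of C]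
      ordered_triangles_le_rainbow_plus_monochromatic[OF assms(1), of C]
      ordered_rainbow_triangles_le[OF assms(1), of C] assms(2)
    by (simp add: d_def c_def)
  have vertexwise: "2 * (d v * c v) - real n * d v + (real n - d v - 1) * (d v - c v)
      \<le> 2 * d v ^ 2 - real n * d v - 3 * ((d v - c v + 1) * (d v - c v))" if "v \<in> V" for v
  proof -
    have "c v \<ge> (real n + 1) / 2"
    proof -
      have "min_color_degree V E C \<le> color_degree E C v"
        unfolding min_color_degree_def using finV that by (intro Min_le) auto
      then show ?thesis using assms(3) by (simp add: c_def)
    qed
    moreover have "n \<ge> 1"
      using that finV assms(2) by (metis One_nat_def Suc_leI card_gt_0_iff empty_iff)
    ultimately have "0 \<le> 3 * c v - real n - 2" by simp
    moreover have "0 \<le> d v - c v"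
      using color_degree_le_degree[OF assms(1)] by (simp add: d_def c_def)
    ultimately have "0 \<le> (d v - c v) * (3 * c v - real n - 2)" by (intro mult_nonneg_nonneg)
    then show ?thesis by (simp add: algebra_simps power2_eq_square)
  qed
  have "2 * (real (card E) * (\<sigma> - real n)) + (\<Sum>v\<in>V. (real n - d v - 1) * (d v - c v))
      \<le> 2 * (\<Sum>v\<in>V. d v * c v) - real n * (\<Sum>v\<in>V. d v)
          + (\<Sum>v\<in>V. (real n - d v - 1) * (d v - c v))"
    using edges_times_min_edge_color_degree_sum_le[OF assms(1), of C] handshake[OF assms(1)]
    by (simp add: \<sigma>_def d_def c_def algebra_simps)
  also have "\<dots> = (\<Sum>v\<in>V. 2 * (d v * c v) - real n * d v + (real n - d v - 1) * (d v - c v))"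
    by (simp add: sum.distrib sum_subtractf sum_distrib_left)
  also have "\<dots> \<le> (\<Sum>v\<in>V. 2 * d v ^ 2 - real n * d v - 3 * ((d v - c v + 1) * (d v - c v)))"
    by (rule sum_mono) (rule vertexwise)
  also have "\<dots> \<le> 6 * real (rt E C)"
    using rainbow by (simp add: sum_subtractf sum_distrib_left)
  finally show ?thesis by (simp add: \<sigma>_def d_def c_def field_simps)
qed

end
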